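(* Assume the Riemann hypothesis, and assume that the set of positive imaginary parts of the nontrivial zeros of the Riemann zeta function $\zeta(s)$ is linearly independent over $\mathbb{Q}$. For $y>0$, let $\mu_y$ be the infinitely divisible distribution on $\mathbb{R}$ whose characteristic function is $\exp(y g_{H_1}(t))$, i.e. $$\exp(y g_{H_1}(t))=\int_{-\infty}^{\infty}e^{itx}\,\mu_y(dx)\qquad(t\in\mathbb{R}).$$ Then the point mass of $\mu_y$ at the origin is $$\mu_y(\{0\})=e^{-yH_1(1)}\,\widetilde{M_{H_1}}(-iy)=e^{-yH_1(1)}\prod_{\gamma>0}J_0\!\left(\frac{2iy\,m_\gamma}{1/4+\gamma^2}\right),$$ where $\widetilde{M_{H_1}}(z)=\frac{1}{\sqrt{2\pi}}\int_{\mathbb{R}}M_{H_1}(u)e^{izu}\,du$ $(z\in\mathbb{C})$, the product ranges over all positive imaginary parts $\gamma$ of nontrivial zeros of $\zeta(s)$ without multiplicity, $m_\gamma$ is the multiplicity of the nontrivial zero $1/2+i\gamma$, and $J_0$ is the Bessel function of the first kind of order zero.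
   Context: For $X>0$, $H_1(X):=\sum_{\rho}\frac{X^{\rho-1/2}}{\rho(1-\rho)}$, where the (absolutely convergent) sum runs over all nontrivial zeros $\rho$ of $\zeta(s)$ (zeros with $0<\Re(\rho)<1$), counted with multiplicity; $H_1$ is real-valued. Put $g_{H_1}(t):=H_1(e^t)-H_1(1)$ for $t\in\mathbb{R}$. Under the stated hypotheses, $M_{H_1}:\mathbb{R}\to\mathbb{R}_{\ge0}$ denotes the $M$-function of $H_1$: the continuous, nonnegative, compactly supported function with $\frac{1}{\sqrt{2\pi}}\int_{\mathbb{R}}M_{H_1}(u)\,du=1$ such that $$\lim_{T\to\infty}\frac1T\int_0^T\Phi(H_1(e^t))\,dt=\frac{1}{\sqrt{2\pi}}\int_{\mathbb{R}}M_{H_1}(u)\Phi(u)\,du$$ for every locally Riemann integrable $\Phi:\mathbb{R}\to\mathbb{C}$ (Riemann integrable on every bounded interval). A distribution on $\mathbb{R}$ means a Borel probability measure; it is infinitely divisible if for every positive integer $n$ it is the $n$-fold convolution of some distribution with itself. Under the Riemann hypothesis the distribution $\mu_y$ exists. *)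

theory Defs
  imports "HOL-Probability.Probability" "HOL-Complex_Analysis.Complex_Analysis"
begin

section \<open>The Riemann zeta function and its nontrivial zeros\<close>

text \<open>
  \<open>zeta s\<close> is the value at \<open>s \<noteq> 1\<close> of the analytic continuation of the Dirichlet series
  \<open>\<Sum>n\<ge>1. n\<^sup>-\<^sup>s\<close>. Since every punctured half-plane \<open>{z. \<sigma> < Re z} - {1}\<close> is connected, all
  continuations to such sets agree at \<open>s\<close>, so that \<open>\<sigma>\<close> is immaterial.
  The value at the pole \<open>1\<close> is unspecified.
\<close>

definition zeta_continuation :: "real \<Rightarrow> (complex \<Rightarrow> complex) \<Rightarrow> bool" where
  "zeta_continuation \<sigma> f \<longleftrightarrow>
     f holomorphic_on ({z. \<sigma> < Re z} - {1}) \<and>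
     (\<forall>z. 1 < Re z \<longrightarrow> (\<lambda>n. 1 / of_nat (Suc n) powr z) sums f z)"

definition zeta :: "complex \<Rightarrow> complex" where
  "zeta s = (THE w. \<exists>\<sigma> f. \<sigma> < min 1 (Re s) \<and> zeta_continuation \<sigma> f \<and> w = f s)"

definition nontrivial_zeros :: "complex set" where
  "nontrivial_zeros = {\<rho>. 0 < Re \<rho> \<and> Re \<rho> < 1 \<and> zeta \<rho> = 0}"

definition zero_mult :: "complex \<Rightarrow> nat" where
  "zero_mult \<rho> = nat (zorder zeta \<rho>)"

definition ordinates :: "real set" where
  "ordinates = {\<gamma>. 0 < \<gamma> \<and> (\<exists>\<rho>\<in>nontrivial_zeros. Im \<rho> = \<gamma>)}"

definition Riemann_hypothesis :: bool where
  "Riemann_hypothesis \<longleftrightarrow> (\<forall>\<rho>\<in>nontrivial_zeros. Re \<rho> = 1 / 2)"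

definition rat_linearly_independent :: "real set \<Rightarrow> bool" where
  "rat_linearly_independent S \<longleftrightarrow> module.independent (\<lambda>(q::rat) (x::real). of_rat q * x) S"

section \<open>The function \<open>H\<^sub>1\<close>\<close>

text \<open>
  The sum is real, by the symmetry of the zeros under complex conjugation; \<open>Re\<close> only changes
  the type.
\<close>

definition H1 :: "real \<Rightarrow> real" where
  "H1 X = Re (\<Sum>\<^sub>\<infinity>\<rho>\<in>nontrivial_zeros.
     of_nat (zero_mult \<rho>) * (of_real X powr (\<rho> - 1 / 2) / (\<rho> * (1 - \<rho>))))"

definition g_H1 :: "real \<Rightarrow> real" where
  "g_H1 t = H1 (exp t) - H1 1"

section \<open>\<open>M\<close>-functions\<close>

text \<open>
  Riemann integrability: Riemann sums converge as the mesh tends to 0. In contrast to the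
  Henstock-Kurzweil integral (\<open>integrable_on\<close>), the gauge \<open>\<lambda>x. ball x \<delta>\<close> has constant radius.
\<close>

definition Riemann_integrable :: "(real \<Rightarrow> complex) \<Rightarrow> real \<Rightarrow> real \<Rightarrow> bool" where
  "Riemann_integrable f a b \<longleftrightarrow>
     (\<exists>I. \<forall>\<epsilon>>0. \<exists>\<delta>>0. \<forall>p. p tagged_division_of {a..b} \<and> (\<lambda>x. ball x \<delta>) fine p \<longrightarrow>
        norm ((\<Sum>(x, k)\<in>p. measure lborel k *\<^sub>R f x) - I) < \<epsilon>)"

definition locally_Riemann_integrable :: "(real \<Rightarrow> complex) \<Rightarrow> bool" where
  "locally_Riemann_integrable f \<longleftrightarrow> (\<forall>a b. a \<le> b \<longrightarrow> Riemann_integrable f a b)"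

definition is_M_function :: "(real \<Rightarrow> real) \<Rightarrow> (real \<Rightarrow> real) \<Rightarrow> bool" where
  "is_M_function H M \<longleftrightarrow>
     continuous_on UNIV M \<and> (\<forall>u. 0 \<le> M u) \<and> compact (closure {u. M u \<noteq> 0}) \<and>
     1 / sqrt (2 * pi) * integral UNIV M = 1 \<and>
     (\<forall>\<Phi>::real \<Rightarrow> complex. locally_Riemann_integrable \<Phi> \<longrightarrow>
        ((\<lambda>T. of_real (1 / T) * integral {0..T} (\<lambda>t. \<Phi> (H (exp t))))
           \<longlongrightarrow> of_real (1 / sqrt (2 * pi)) * integral UNIV (\<lambda>u. of_real (M u) * \<Phi> u)) at_top)"

definition M_transform :: "(real \<Rightarrow> real) \<Rightarrow> complex \<Rightarrow> complex" where
  "M_transform M z =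
     of_real (1 / sqrt (2 * pi)) * integral UNIV (\<lambda>u. of_real (M u) * exp (\<i> * of_real u * z))"

section \<open>Infinitely divisible distributions\<close>

primrec conv_power :: "real measure \<Rightarrow> nat \<Rightarrow> real measure" where
  "conv_power \<nu> 0 = return borel 0"
| "conv_power \<nu> (Suc n) = convolution \<nu> (conv_power \<nu> n)"

definition infinitely_divisible :: "real measure \<Rightarrow> bool" where
  "infinitely_divisible \<mu> \<longleftrightarrow>
     real_distribution \<mu> \<and> (\<forall>n\<ge>1. \<exists>\<nu>. real_distribution \<nu> \<and> \<mu> = conv_power \<nu> n)"

section \<open>The Bessel function \<open>J\<^sub>0\<close> and unordered products\<close>

definition Bessel_J0 :: "complex \<Rightarrow> complex" where
  "Bessel_J0 z = (\<Sum>k. (- 1) ^ k / (fact k) ^ 2 * (z / 2) ^ (2 * k))"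

text \<open>Multiplicative analogue of \<open>has_sum\<close>; the limit 0 is not excluded.\<close>

definition has_unordered_prod :: "('a \<Rightarrow> complex) \<Rightarrow> complex \<Rightarrow> 'a set \<Rightarrow> bool" where
  "has_unordered_prod f P A \<longleftrightarrow> ((\<lambda>F. \<Prod>x\<in>F. f x) \<longlongrightarrow> P) (finite_subsets_at_top A)"

end

theory Submission
  imports Defs
begin

text \<open>
  The point mass \<open>\<mu>\<^sub>y({0})\<close> is the mean of the characteristic function over \<open>[0, T]\<close> as
  \<open>T \<rightarrow> \<infinity>\<close>, hence \<open>exp (- y H\<^sub>1(1))\<close> times the mean of \<open>exp (y H\<^sub>1(e\<^sup>t))\<close>, and the latter is
  the transform of \<open>M\<close> at \<open>- i y\<close> by the defining property of \<open>M\<close> for \<open>\<Phi> u = e\<^sup>y\<^sup>u\<close>.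
  Under the Riemann hypothesis \<open>H\<^sub>1(e\<^sup>t)\<close> is an absolutely convergent series
  \<open>\<Sum>\<^sub>\<gamma> 2 m\<^sub>\<gamma> cos (\<gamma> t) / (1/4 + \<gamma>\<^sup>2)\<close> over \<open>\<gamma> > 0\<close>; its exponential is a uniform limit of finite
  products whose means factor into Bessel functions by linear independence.

  Convergence of the series needs no zero counting: were it divergent, \<open>infsum\<close> would make \<open>H1\<close>
  vanish identically, and the zero function has no \<open>M\<close>-function. There is no term with \<open>\<gamma> = 0\<close>
  because \<open>\<zeta>(1/2) \<noteq> 0\<close>, which follows from positivity of the alternating series
  \<open>\<Sum>n. (-1)\<^sup>n (n+1)\<^sup>-\<^sup>s = (1 - 2\<^sup>1\<^sup>-\<^sup>s) \<zeta>(s)\<close> at \<open>s = 1/2\<close>.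
\<close>

section \<open>Mean values\<close>

text \<open>The average has exactly the shape occurring in \<open>is_M_function\<close>, so the
  defining property of \<open>M\<close> is itself a \<open>has_mean\<close> statement.\<close>

definition has_mean :: "(real \<Rightarrow> complex) \<Rightarrow> complex \<Rightarrow> bool" where
  "has_mean f c \<longleftrightarrow> ((\<lambda>T. of_real (1 / T) * integral {0..T} f) \<longlongrightarrow> c) at_top"

section \<open>Exchanging limits with means\<close>

lemma uniform_limit_average:
  assumes lim: "uniform_limit UNIV f h F" and "F \<noteq> bot"
    and cont: "\<forall>\<^sub>F n in F. continuous_on UNIV (f n)"
  shows "uniform_limit {0<..} (\<lambda>n T. complex_of_real (1 / T) * integral {0..T} (f n))
    (\<lambda>T. of_real (1 / T) * integral {0..T} h) F"
proof (rule uniform_limitI)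
  fix e :: real assume e: "e > 0"
  have conth: "continuous_on UNIV h"
    using uniform_limit_theorem[OF cont lim] \<open>F \<noteq> bot\<close> by simp
  \<comment> \<open>Integration yields only a non-strict bound; halving \<open>e\<close> restores
    strictness. The factor \<open>1 / T\<close> cancels the length \<open>T\<close>, so the estimate
    is uniform in \<open>T\<close>.\<close>
  have "\<forall>\<^sub>F n in F. \<forall>x\<in>UNIV. dist (f n x) (h x) < e / 2"
    using uniform_limitD[OF lim, of "e/2"] e by simp
  with cont show "\<forall>\<^sub>F n in F. \<forall>T\<in>{0<..}. dist (of_real (1 / T) * integral {0..T} (f n))
      (of_real (1 / T) * integral {0..T} h) < e"
  proof eventually_elim
    case (elim n)
    show ?case
    proof
      fix T :: real assume "T \<in> {0<..}"
      then have T: "T > 0" by simp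
      have i: "f n integrable_on {0..T}" "h integrable_on {0..T}"
        using elim conth by (auto intro!: integrable_continuous_interval intro: continuous_on_subset)
      have "norm (integral {0..T} (\<lambda>x. f n x - h x)) \<le> (e/2) * (T - 0)"
      proof (rule integral_bound)
        show "continuous_on {0..T} (\<lambda>x. f n x - h x)"
          using elim conth by (intro continuous_on_diff) (auto intro: continuous_on_subset)
        show "norm (f n x - h x) \<le> e / 2" for x
          using elim by (auto simp: dist_norm intro: less_imp_le)
      qed (use T in simp)
      then have "norm (integral {0..T} (f n) - integral {0..T} h) \<le> (e/2) * T"
        using i by (simp add: integral_diff)
      then have "dist (of_real (1 / T) * integral {0..T} (f n))
          (of_real (1 / T) * integral {0..T} h) \<le> (1/T) * ((e/2) * T)"
        using T unfolding dist_norm right_diff_distrib[symmetric] norm_mult norm_of_real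
        by (intro mult_mono) auto
      also have "\<dots> < e" using T e by simp
      finally show "dist (of_real (1 / T) * integral {0..T} (f n))
          (of_real (1 / T) * integral {0..T} h) < e" .
    qed
  qed
qed

lemma has_mean_uniform_limit:
  assumes "uniform_limit UNIV f h F" "F \<noteq> bot"
    and "\<forall>\<^sub>F n in F. continuous_on UNIV (f n)"
    and "\<forall>\<^sub>F n in F. has_mean (f n) (c n)" and "(c \<longlongrightarrow> l) F"
  shows "has_mean h l"
  using swap_uniform_limit'[OF assms(4)[unfolded has_mean_def] assms(5) uniform_limit_average[OF assms(1-3)]]
    assms(2) eventually_gt_at_top[of 0] by (auto simp: has_mean_def)

text \<open>Here the mean of the limit function is given and convergence of the approximating means
  is deduced. This later gives convergence of the Bessel product without any estimate of
  J_0.\<close>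

lemma tendsto_has_mean:
  assumes lim: "uniform_limit UNIV f h F" "F \<noteq> bot"
    and cont: "\<forall>\<^sub>F n in F. continuous_on UNIV (f n)"
    and c: "\<forall>\<^sub>F n in F. has_mean (f n) (c n)" and l: "has_mean h l"
  shows "(c \<longlongrightarrow> l) F"
proof (rule tendstoI)
  fix e :: real assume e: "e > 0"
  have "\<forall>\<^sub>F n in F. \<forall>T\<in>{0<..}. dist (complex_of_real (1 / T) * integral {0..T} (f n))
      (of_real (1 / T) * integral {0..T} h) < e / 2"
    using uniform_limitD[OF uniform_limit_average[OF lim cont], of "e/2"] e by simp
  with c show "\<forall>\<^sub>F n in F. dist (c n) l < e"
  proof eventually_elim
    case (elim n)
    have "((\<lambda>T. dist (complex_of_real (1 / T) * integral {0..T} (f n))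
      (of_real (1 / T) * integral {0..T} h)) \<longlongrightarrow> dist (c n) l) at_top"
      using elim l unfolding has_mean_def by (intro tendsto_dist)
    then have "dist (c n) l \<le> e / 2"
    proof (rule tendsto_upperbound)
      show "\<forall>\<^sub>F T in at_top. dist (complex_of_real (1 / T) * integral {0..T} (f n))
        (of_real (1 / T) * integral {0..T} h) \<le> e / 2"
        using eventually_gt_at_top[of 0] by eventually_elim (use elim in \<open>auto intro: less_imp_le\<close>)
    qed simp
    then show ?case using e by simp
  qed
qed

lemma has_mean_mult:
  assumes "has_mean f c"
  shows "has_mean (\<lambda>t. a * f t) (a * c)"
proof -
  have "((\<lambda>T. a * (of_real (1 / T) * integral {0..T} f)) \<longlongrightarrow> a * c) at_top"
    using assms unfolding has_mean_def by (intro tendsto_intros)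
  then show ?thesis by (simp add: has_mean_def mult_ac)
qed

lemma has_mean_sum:
  assumes "finite A" "\<And>x. x \<in> A \<Longrightarrow> continuous_on UNIV (f x)" "\<And>x. x \<in> A \<Longrightarrow> has_mean (f x) (c x)"
  shows "has_mean (\<lambda>t. \<Sum>x\<in>A. f x t) (\<Sum>x\<in>A. c x)"
proof -
  have "((\<lambda>T. \<Sum>x\<in>A. of_real (1 / T) * integral {0..T} (f x)) \<longlongrightarrow> (\<Sum>x\<in>A. c x)) at_top"
    using assms unfolding has_mean_def by (intro tendsto_intros) auto
  moreover have "integral {0..T} (\<lambda>t. \<Sum>x\<in>A. f x t) = (\<Sum>x\<in>A. integral {0..T} (f x))" for T
    using assms by (intro integral_sum) (auto intro!: integrable_continuous_interval intro: continuous_on_subset)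
  ultimately show ?thesis by (simp add: has_mean_def sum_distrib_left)
qed

lemma has_mean_const: "has_mean (\<lambda>t. c) c"
proof -
  have "\<forall>\<^sub>F T in at_top. complex_of_real (1 / T) * integral {0..T} (\<lambda>t. c) = c"
    using eventually_gt_at_top[of 0] by eventually_elim (simp add: scaleR_conv_of_real)
  then show ?thesis unfolding has_mean_def by (simp add: tendsto_eventually)
qed

section \<open>Means of exponentials and the point mass at the origin\<close>

lemma has_integral_cis:
  assumes "x \<noteq> 0" "0 \<le> T"
  shows "((\<lambda>t. cis (x * t)) has_integral (cis (x * T) - 1) / (\<i> * of_real x)) {0..T}"
proof -
  have "((\<lambda>t. cis (x * t)) has_integral
      cis (x * T) / (\<i> * of_real x) - cis (x * 0) / (\<i> * of_real x)) {0..T}"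
  proof (rule fundamental_theorem_of_calculus[OF assms(2)])
    fix t :: real
    have "((\<lambda>z. exp (\<i> * of_real x * z) / (\<i> * of_real x)) has_field_derivative exp (\<i> * of_real x * of_real t))
      (at (of_real t))"
      using assms by (auto intro!: derivative_eq_intros)
    from has_vector_derivative_real_field[OF this]
    show "((\<lambda>t. cis (x * t) / (\<i> * of_real x)) has_vector_derivative cis (x * t)) (at t within {0..T})"
      by (simp add: cis_conv_exp mult_ac)
  qed
  then show ?thesis by (simp add: diff_divide_distrib)
qed

text \<open>Supplies the dominating constant for the limit under the integral in
  \<open>has_mean_char\<close>.\<close>

lemma norm_average_cis_le:
  assumes "0 \<le> T"
  shows "norm (of_real (1 / T) * integral {0..T} (\<lambda>t. cis (x * t))) \<le> 1"
proof -
  have "norm (integral {0..T} (\<lambda>t. cis (x * t))) \<le> 1 * (T - 0)"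
    using assms by (intro integral_bound) (auto intro!: continuous_intros)
  then show ?thesis using assms by (cases "T = 0") (auto simp: norm_mult norm_divide field_simps)
qed

text \<open>For \<open>x \<noteq> 0\<close> the antiderivative is bounded, so the average decays
  like 1/T.\<close>

lemma has_mean_cis: "has_mean (\<lambda>t. cis (x * t)) (if x = 0 then 1 else 0)"
proof (cases "x = 0")
  case True
  then show ?thesis by (simp add: has_mean_const)
next
  case False
  have "((\<lambda>T. of_real (1 / T) * integral {0..T} (\<lambda>t. cis (x * t))) \<longlongrightarrow> 0) at_top"
  proof (rule Lim_null_comparison)
    show "\<forall>\<^sub>F T in at_top. norm (of_real (1 / T) * integral {0..T} (\<lambda>t. cis (x * t))) \<le> 2 / \<bar>x\<bar> * (1 / T)"
      using eventually_gt_at_top[of 0]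
    proof eventually_elim
      case (elim T)
      have "norm (cis (x * T) - 1) \<le> 2"
        using norm_triangle_ineq4[of "cis (x * T)" 1] by simp
      moreover have "integral {0..T} (\<lambda>t. cis (x * t)) = (cis (x * T) - 1) / (\<i> * of_real x)"
        using has_integral_cis[of x T] elim False by (intro integral_unique) simp
      ultimately show ?case using elim False
        by (simp add: norm_mult norm_divide mult.commute[of T] divide_right_mono)
    qed
    show "((\<lambda>T. 2 / \<bar>x\<bar> * (1 / T)) \<longlongrightarrow> 0) at_top"
      by (intro tendsto_mult_right_zero tendsto_divide_0[OF tendsto_const] filterlim_at_top_imp_at_infinity filterlim_ident)
  qed
  then show ?thesis using False by (simp add: has_mean_def)
qed

text \<open>Averaging over \<open>[0, T]\<close> turns \<open>e\<^sup>i\<^sup>t\<^sup>x\<close> into a bounded approximation of the indicator of \<open>x = 0\<close>.\<close>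

lemma has_mean_char:
  assumes "real_distribution \<mu>"
  shows "has_mean (char \<mu>) (of_real (measure \<mu> {0}))"
proof -
  interpret real_distribution \<mu> by fact
  have [measurable_cong]: "sets \<mu> = sets borel" by simp
  define A where "A T x = complex_of_real (1 / T) * integral {0..T} (\<lambda>t. cis (x * t))" for T x :: real
  have A: "A T x = (LINT t|lborel. indicator {0..T} t *\<^sub>R cis (x * t)) * of_real (1 / T)" for T x
  proof -
    have "set_integrable lborel {0..T} (\<lambda>t. cis (x * t))"
      by (intro borel_integrable_compact[unfolded set_integrable_def[symmetric]])
        (auto intro!: continuous_intros simp: set_integrable_def intro!: borel_integrable_compact)
    from set_borel_integral_eq_integral(2)[OF this] show ?thesis
      by (simp add: A_def set_lebesgue_integral_def)
  qed
  \<comment> \<open>Fubini exchanges averaging over \<open>t\<close> with integration over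
    \<open>\<mu>\<close>; the integrand is bounded by 1 on a set of finite measure.\<close>
  have char_eq: "of_real (1 / T) * integral {0..T} (char \<mu>) = (LINT x|\<mu>. A T x)" if "T > 0" for T
  proof -
    interpret P: pair_sigma_finite \<mu> lborel ..
    have int: "integrable (\<mu> \<Otimes>\<^sub>M lborel) (\<lambda>(x, t). indicator {0..T} t *\<^sub>R cis (x * t))"
    proof (rule integrableI_bounded_set[where A = "UNIV \<times> {0..T}" and B = 1])
      show "UNIV \<times> {0..T} \<in> sets (\<mu> \<Otimes>\<^sub>M lborel)"
        using space_eq_univ sets.top[of \<mu>] by (intro pair_measureI) auto
      show "emeasure (\<mu> \<Otimes>\<^sub>M lborel) (UNIV \<times> {0..T}) < \<infinity>"
        using that emeasure_space_1 space_eq_univ sets.top[of \<mu>]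
        by (subst lborel.emeasure_pair_measure_Times) auto
      show "(\<lambda>(x, t). indicator {0..T} t *\<^sub>R cis (x * t)) \<in> borel_measurable (\<mu> \<Otimes>\<^sub>M lborel)"
        unfolding cis_conv_exp by measurable
      show "AE x in \<mu> \<Otimes>\<^sub>M lborel. x \<in> UNIV \<times> {0..T} \<longrightarrow>
         norm (case x of (x, t) \<Rightarrow> indicator {0..T} t *\<^sub>R cis (x * t)) \<le> 1"
        by (auto simp: indicator_def)
    qed (auto simp: indicator_def)
    have "(LINT x|\<mu>. A T x) = (LINT x|\<mu>. (LINT t|lborel. indicator {0..T} t *\<^sub>R cis (x * t))) * of_real (1 / T)"
      unfolding A by (rule integral_mult_left_zero)
    also have "(LINT x|\<mu>. (LINT t|lborel. indicator {0..T} t *\<^sub>R cis (x * t))) =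
        (LINT t|lborel. (LINT x|\<mu>. indicator {0..T} t *\<^sub>R cis (x * t)))"
      using P.Fubini_integral[OF int] by simp
    also have "\<dots> = (LINT t|lborel. indicator {0..T} t *\<^sub>R char \<mu> t)"
      by (simp add: char_def cis_conv_exp mult_ac)
    also have "\<dots> = integral {0..T} (char \<mu>)"
    proof -
      have "continuous_on UNIV (char \<mu>)"
        using isCont_char by (intro continuous_at_imp_continuous_on) auto
      then have "set_integrable lborel {0..T} (char \<mu>)"
        unfolding set_integrable_def
        by (intro borel_integrable_compact) (auto intro: continuous_on_subset)
      from set_borel_integral_eq_integral(2)[OF this] show ?thesis
        by (simp add: set_lebesgue_integral_def)
    qed
    finally show ?thesis by simp
  qed
  \<comment> \<open>Dominated convergence: the constant 1 is integrable because \<open>\<mu>\<close>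
    is a probability measure, and the pointwise limit is \<open>has_mean_cis\<close> at frequency
    \<open>x\<close>.\<close>
  have "((\<lambda>T. LINT x|\<mu>. A T x) \<longlongrightarrow> (LINT x|\<mu>. indicator {0} x)) at_top"
  proof (rule integral_dominated_convergence_at_top[where w = "\<lambda>_. 1"])
    show "\<forall>\<^sub>F T in at_top. AE x in \<mu>. norm (A T x) \<le> 1"
      using eventually_ge_at_top[of 0]
      by eventually_elim (auto simp: A_def intro: norm_average_cis_le[simplified])
    have "((\<lambda>T. A T x) \<longlongrightarrow> indicator {0} x) at_top" for x
      using has_mean_cis[of x] unfolding A_def has_mean_def indicator_def by (cases "x = 0") simp_all
    then show "AE x in \<mu>. ((\<lambda>T. A T x) \<longlongrightarrow> indicator {0} x) at_top"
      by simp
    show "A T \<in> borel_measurable \<mu>" for T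
      unfolding A cis_conv_exp by measurable
    show "(\<lambda>x. indicator {0} x :: complex) \<in> borel_measurable \<mu>"
      by measurable
  qed simp
  also have "(LINT x|\<mu>. indicator {0} x) = complex_of_real (measure \<mu> {0})"
  proof -
    have "(indicator {0} x :: complex) = of_real (indicator {0} x)" for x :: real
      by (rule of_real_indicator[symmetric])
    then have "(LINT x|\<mu>. indicator {0} x) = (LINT x|\<mu>. complex_of_real (indicator {0} x))"
      by (simp only:)
    also have "\<dots> = complex_of_real (measure \<mu> {0})"
      unfolding integral_complex_of_real by simp
    finally show ?thesis .
  qed
  finally show ?thesis
    unfolding has_mean_def
    by (rule Lim_transform_eventually) (use eventually_gt_at_top[of 0] in eventually_elim, use char_eq in auto)
qed

section \<open>Means of exponentials of trigonometric sums\<close>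

lemma has_mean_series:
  assumes cont: "\<And>n. continuous_on UNIV (f n)"
    and bound: "\<And>n t. norm (f n t) \<le> b n" and "summable b"
    and mean: "\<And>n. has_mean (f n) (c n)"
    and h: "\<And>t. (\<lambda>n. f n t) sums h t" and l: "c sums l"
  shows "has_mean h l"
proof (rule has_mean_uniform_limit)
  have "h = (\<lambda>t. \<Sum>n. f n t)"
    using h by (auto simp: sums_iff)
  then show "uniform_limit UNIV (\<lambda>n t. \<Sum>i<n. f i t) h sequentially"
    using Weierstrass_m_test[of UNIV f b] bound \<open>summable b\<close> by simp
  show "\<forall>\<^sub>F n in sequentially. continuous_on UNIV (\<lambda>t. \<Sum>i<n. f i t)"
    using cont by (intro always_eventually allI continuous_intros) auto
  show "\<forall>\<^sub>F n in sequentially. has_mean (\<lambda>t. \<Sum>i<n. f i t) (\<Sum>i<n. c i)"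
    using cont mean by (intro always_eventually allI has_mean_sum) auto
  show "(\<lambda>n. \<Sum>i<n. c i) \<longlonglongrightarrow> l"
    using l by (simp add: sums_def)
qed simp

text \<open>In the power series of the exponential, the term of degree \<open>l\<close> shifts the
  frequencies of \<open>G\<close> by l\<gamma>; the means of these shifts therefore determine the
  result. The sign of \<gamma> is free, which allows both halves of a cosine to be treated.\<close>

lemma has_mean_exp_cis_times:
  assumes cont: "continuous_on UNIV G" and bound: "\<And>t. norm (G t) \<le> B"
    and mean: "\<And>l::nat. has_mean (\<lambda>t. cis (real l * (\<gamma> * t)) * G t) (c l)"
    and l: "(\<lambda>l. w ^ l / fact l * c l) sums s"
  shows "has_mean (\<lambda>t. exp (w * cis (\<gamma> * t)) * G t) s"
proof (rule has_mean_series)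
  let ?f = "\<lambda>l t. w ^ l / fact l * (cis (real l * (\<gamma> * t)) * G t)"
  show "continuous_on UNIV (?f l)" for l
    using cont by (auto intro!: continuous_intros)
  show "norm (?f l t) \<le> norm w ^ l / fact l * B" for l t
    by (simp add: norm_mult norm_divide norm_power mult_left_mono divide_right_mono bound)
  show "summable (\<lambda>l. norm w ^ l / fact l * B)"
    using summable_exp[of "norm w"] by (intro summable_mult2) (simp add: field_simps)
  show "has_mean (?f l) (w ^ l / fact l * c l)" for l
    by (rule has_mean_mult[OF mean])
  show "(\<lambda>l. ?f l t) sums (exp (w * cis (\<gamma> * t)) * G t)" for t
  proof -
    have "(\<lambda>l. (w * cis (\<gamma> * t)) ^ l /\<^sub>R fact l * G t) sums (exp (w * cis (\<gamma> * t)) * G t)"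
      by (rule sums_mult2[OF exp_converges])
    moreover have "(w * cis (\<gamma> * t)) ^ l /\<^sub>R fact l * G t = ?f l t" for l
      by (simp add: power_mult_distrib Complex.DeMoivre scaleR_conv_of_real divide_inverse mult_ac)
    ultimately show ?thesis by simp
  qed
qed fact

text \<open>At the argument 2iw the signs of the Bessel series cancel against the powers of i. The
  terms are written as squares of exponential coefficients, the form in which the diagonal of a
  product of two exponential series arises.\<close>

lemma sums_Bessel_J0:
  "(\<lambda>k. w ^ k / fact k * (w ^ k / fact k)) sums Bessel_J0 (2 * \<i> * w)"
proof -
  have eq: "(- 1) ^ k / (fact k) ^ 2 * (2 * \<i> * w / 2) ^ (2 * k) = w ^ k / fact k * (w ^ k / fact k)" for k
  proof -
    have "(- 1) ^ k * (2 * \<i> * w / 2) ^ (2 * k) = ((- 1) * (\<i> * w)\<^sup>2) ^ k"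
      unfolding power_mult power_mult_distrib[of "- 1"] by simp
    also have "(- 1) * (\<i> * w)\<^sup>2 = w * w"
      by (simp only: power_mult_distrib i_squared) (simp add: power2_eq_square)
    finally show ?thesis
      by (simp add: power_mult_distrib power2_eq_square)
  qed
  have "summable (\<lambda>k. norm (w ^ k / fact k * (w ^ k / fact k)))"
  proof (rule summable_comparison_test')
    show "summable (\<lambda>k. norm (w ^ k /\<^sub>R fact k) * exp (norm w))"
      by (intro summable_mult2 summable_norm_exp)
    \<comment> \<open>One factor is bounded by a single term of the exponential series; the other
      factor supplies summability.\<close>
    have "norm (w ^ k) / fact k \<le> exp (norm w)" for k
    proof -
      have "norm (w ^ k) / fact k = (\<Sum>i\<in>{k}. norm w ^ i /\<^sub>R fact i)"
        by (simp add: norm_power field_simps)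
      also have "\<dots> \<le> (\<Sum>i. norm w ^ i /\<^sub>R fact i)"
        using summable_exp[of "norm w"] by (intro sum_le_suminf) (auto simp: mult.commute)
      finally show ?thesis by (simp add: exp_def)
    qed
    then show "norm (norm (w ^ k / fact k * (w ^ k / fact k))) \<le> norm (w ^ k /\<^sub>R fact k) * exp (norm w)"
      if "k \<ge> 0" for k
      unfolding norm_mult norm_divide norm_scaleR
      by (simp add: divide_inverse_commute mult_left_mono norm_power norm_mult)
  qed
  from summable_sums[OF summable_norm_cancel[OF this]] show ?thesis
    unfolding Bessel_J0_def eq .
qed

text \<open>
  Since \<open>2 w cos \<theta> = w e\<^sup>i\<^sup>\<theta> + w e\<^sup>-\<^sup>i\<^sup>\<theta>\<close>, the exponential is a product of two power series, of
  which only the diagonal terms have a nonzero mean.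
\<close>

lemma has_mean_exp_cos_times:
  assumes cont: "continuous_on UNIV G" and bound: "\<And>t. norm (G t) \<le> B"
    and mean: "\<And>k::int. has_mean (\<lambda>t. cis (real_of_int k * \<gamma> * t) * G t) (if k = 0 then c else 0)"
  shows "has_mean (\<lambda>t. exp (2 * w * of_real (cos (\<gamma> * t))) * G t) (Bessel_J0 (2 * \<i> * w) * c)"
proof -
  \<comment> \<open>The negative-frequency half of the cosine is absorbed into \<open>G'\<close>;
    the positive half is expanded first, and \<open>G'\<close> inside each of its terms.\<close>
  define G' where "G' t = exp (w * cis (- \<gamma> * t)) * G t" for t
  have G': "continuous_on UNIV G'"
    unfolding G'_def by (intro continuous_intros cont)
  have bound': "norm (G' t) \<le> exp (norm w) * B" for t
  proof -
    have "norm (exp (w * cis (- \<gamma> * t))) \<le> exp (norm (w * cis (- \<gamma> * t)))"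
      by (rule norm_exp)
    then show ?thesis
      unfolding G'_def norm_mult by (intro mult_mono bound) (auto simp: norm_mult)
  qed
  have "has_mean (\<lambda>t. exp (w * cis (\<gamma> * t)) * G' t) (Bessel_J0 (2 * \<i> * w) * c)"
  proof (rule has_mean_exp_cis_times[OF G' bound'])
    fix j :: nat
    have "has_mean (\<lambda>t. exp (w * cis (- \<gamma> * t)) * (cis (real j * (\<gamma> * t)) * G t)) (w ^ j / fact j * c)"
    proof (rule has_mean_exp_cis_times)
      show "continuous_on UNIV (\<lambda>t. cis (real j * (\<gamma> * t)) * G t)"
        by (intro continuous_intros cont)
      show "norm (cis (real j * (\<gamma> * t)) * G t) \<le> B" for t
        by (simp add: norm_mult bound)
      show "has_mean (\<lambda>t. cis (real l * (- \<gamma> * t)) * (cis (real j * (\<gamma> * t)) * G t)) (if l = j then c else 0)" for l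
      proof -
        \<comment> \<open>The net frequency is (j - l)\<gamma>, so by \<open>mean\<close> only
          \<open>l = j\<close> contributes.\<close>
        have eq: "cis (real_of_int (int j - int l) * \<gamma> * t) * G t
            = cis (real l * (- \<gamma> * t)) * (cis (real j * (\<gamma> * t)) * G t)" for t
        proof -
          have arg: "real_of_int (int j - int l) * \<gamma> * t = real l * (- \<gamma> * t) + real j * (\<gamma> * t)"
            by (simp add: algebra_simps)
          show ?thesis
            unfolding arg cis_mult[symmetric] mult.assoc[of "cis _"] by (rule refl)
        qed
        have "(if int j - int l = 0 then c else 0) = (if l = j then c else 0)"
          by simp
        with mean[of "int j - int l"] show ?thesis
          unfolding eq by argo
      qed
      show "(\<lambda>l. w ^ l / fact l * (if l = j then c else 0)) sums (w ^ j / fact j * c)"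
      proof -
        have "(\<lambda>l. w ^ l / fact l * (if l = j then c else 0)) = (\<lambda>l. if l = j then w ^ l / fact l * c else 0)"
          by auto
        then show ?thesis
          using sums_single[of j "\<lambda>l. w ^ l / fact l * c"] by argo
      qed
    qed
    then show "has_mean (\<lambda>t. cis (real j * (\<gamma> * t)) * G' t) (w ^ j / fact j * c)"
      unfolding G'_def mult.left_commute[of "cis (real j * _)"] .
  next
    show "(\<lambda>l. w ^ l / fact l * (w ^ l / fact l * c)) sums (Bessel_J0 (2 * \<i> * w) * c)"
      using sums_mult2[OF sums_Bessel_J0[of w], of c] by (simp only: mult.assoc)
  qed
  moreover have "exp (w * cis (\<gamma> * t)) * G' t = exp (2 * w * of_real (cos (\<gamma> * t))) * G t" for t
  proof -
    have "w * cis (\<gamma> * t) + w * cis (- \<gamma> * t) = 2 * w * of_real (cos (\<gamma> * t))"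
    proof -
      have "w * cis (\<gamma> * t) + w * cis (- \<gamma> * t) = w * (cis (\<gamma> * t) + cis (- \<gamma> * t))"
        by (rule distrib_left[symmetric])
      also have "cis (\<gamma> * t) + cis (- \<gamma> * t) = 2 * of_real (cos (\<gamma> * t))"
        by (simp add: complex_eq_iff)
      finally show ?thesis
        by (simp only: mult.assoc mult.left_commute)
    qed
    then show ?thesis
      unfolding G'_def by (metis exp_add mult.assoc)
  qed
  ultimately show ?thesis by simp
qed

text \<open>The scaling is the one used in \<open>rat_linearly_independent\<close>, so span and
  independence over the rationals become available for it.\<close>

interpretation rat_real: vector_space "\<lambda>(q::rat) (x::real). of_rat q * x"
  by unfold_locales (auto simp: of_rat_add of_rat_mult algebra_simps)

text \<open>The statement about \<open>x\<close> outside the span makes the induction on \<open>F\<close> work.\<close>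

lemma has_mean_prod_exp_cos:
  fixes w :: "real \<Rightarrow> complex"
  assumes "finite F" "rat_real.independent F"
  shows "has_mean (\<lambda>t. \<Prod>\<gamma>\<in>F. exp (2 * w \<gamma> * of_real (cos (\<gamma> * t)))) (\<Prod>\<gamma>\<in>F. Bessel_J0 (2 * \<i> * w \<gamma>))
    \<and> (\<forall>x. x \<notin> rat_real.span F \<longrightarrow>
        has_mean (\<lambda>t. cis (x * t) * (\<Prod>\<gamma>\<in>F. exp (2 * w \<gamma> * of_real (cos (\<gamma> * t))))) 0)"
  using assms
proof (induction F)
  case empty
  show ?case
    \<comment> \<open>The empty set spans only 0, so \<open>x\<close> outside the span is a nonzero
      frequency.\<close>
    using has_mean_cis has_mean_const[of 1] by (auto simp: rat_real.span_empty) metis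
next
  case (insert \<gamma> F)
  let ?P = "\<lambda>t. \<Prod>\<gamma>\<in>F. exp (2 * w \<gamma> * of_real (cos (\<gamma> * t)))"
  from insert.prems insert.hyps have indep: "rat_real.independent F" and \<gamma>: "\<gamma> \<notin> rat_real.span F"
    by (auto simp: rat_real.independent_insert)
  note IH = insert.IH[OF indep]
  have cont: "continuous_on UNIV ?P"
    by (intro continuous_intros)
  have bound: "norm (?P t) \<le> (\<Prod>\<gamma>\<in>F. exp (norm (2 * w \<gamma>)))" for t
    unfolding prod_norm[symmetric]
  proof (intro prod_mono conjI)
    fix \<gamma>
    have "norm (exp (2 * w \<gamma> * of_real (cos (\<gamma> * t)))) \<le> exp (norm (2 * w \<gamma> * of_real (cos (\<gamma> * t))))"
      by (rule norm_exp)
    also have "\<dots> \<le> exp (norm (2 * w \<gamma>))"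
      using abs_cos_le_one[of "\<gamma> * t"] by (simp add: norm_mult mult_left_le)
    finally show "norm (exp (2 * w \<gamma> * of_real (cos (\<gamma> * t)))) \<le> exp (norm (2 * w \<gamma>))" .
  qed simp
  have "has_mean (\<lambda>t. exp (2 * w \<gamma> * of_real (cos (\<gamma> * t))) * ?P t)
      (Bessel_J0 (2 * \<i> * w \<gamma>) * (\<Prod>\<gamma>\<in>F. Bessel_J0 (2 * \<i> * w \<gamma>)))"
  proof (rule has_mean_exp_cos_times[OF cont bound])
    fix k :: int
    \<comment> \<open>Dividing by \<open>k\<close> would otherwise put \<gamma> into the span of
      \<open>F\<close>, against independence.\<close>
    have "real_of_int k * \<gamma> \<notin> rat_real.span F" if "k \<noteq> 0"
    proof
      assume "real_of_int k * \<gamma> \<in> rat_real.span F"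
      from rat_real.span_scale[OF this, of "1 / of_int k"] that \<gamma> show False
        by (simp add: of_rat_divide)
    qed
    then show "has_mean (\<lambda>t. cis (real_of_int k * \<gamma> * t) * ?P t)
        (if k = 0 then \<Prod>\<gamma>\<in>F. Bessel_J0 (2 * \<i> * w \<gamma>) else 0)"
      using IH by auto
  qed
  moreover have "has_mean (\<lambda>t. cis (x * t) * (exp (2 * w \<gamma> * of_real (cos (\<gamma> * t))) * ?P t)) 0"
    if x: "x \<notin> rat_real.span (insert \<gamma> F)" for x
  proof -
    \<comment> \<open>The same lemma with \<open>cis (x * t)\<close> included in \<open>G\<close>
      and \<open>c = 0\<close>: even the unshifted frequency \<open>k = 0\<close> lies outside the
      span of \<open>F\<close>.\<close>
    have "has_mean (\<lambda>t. exp (2 * w \<gamma> * of_real (cos (\<gamma> * t))) * (cis (x * t) * ?P t))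
      (Bessel_J0 (2 * \<i> * w \<gamma>) * 0)"
    proof (rule has_mean_exp_cos_times)
      show "continuous_on UNIV (\<lambda>t. cis (x * t) * ?P t)"
        by (intro continuous_intros cont)
      show "norm (cis (x * t) * ?P t) \<le> (\<Prod>\<gamma>\<in>F. exp (norm (2 * w \<gamma>)))" for t
        using bound by (simp add: norm_mult)
      fix k :: int
      have "x + real_of_int k * \<gamma> \<notin> rat_real.span F"
      proof
        assume "x + real_of_int k * \<gamma> \<in> rat_real.span F"
        then have "x + real_of_int k * \<gamma> \<in> rat_real.span (insert \<gamma> F)"
          using rat_real.span_mono[of F "insert \<gamma> F"] by auto
        moreover have "of_rat (of_int k) * \<gamma> \<in> rat_real.span (insert \<gamma> F)"
          by (intro rat_real.span_scale rat_real.span_base) simp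
        ultimately have "x + real_of_int k * \<gamma> - of_rat (of_int k) * \<gamma> \<in> rat_real.span (insert \<gamma> F)"
          by (rule rat_real.span_diff)
        then show False using x by simp
      qed
      with IH have "has_mean (\<lambda>t. cis ((x + real_of_int k * \<gamma>) * t) * ?P t) 0" by blast
      moreover have "cis ((x + real_of_int k * \<gamma>) * t) * ?P t
          = cis (real_of_int k * \<gamma> * t) * (cis (x * t) * ?P t)" for t
      proof -
        have "(x + real_of_int k * \<gamma>) * t = real_of_int k * \<gamma> * t + x * t"
          by (simp add: algebra_simps)
        then show ?thesis by (simp only: cis_mult[symmetric] mult.assoc)
      qed
      ultimately show "has_mean (\<lambda>t. cis (real_of_int k * \<gamma> * t) * (cis (x * t) * ?P t)) (if k = 0 then 0 else 0)"
        by simp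
    qed
    then show ?thesis by (simp add: mult_ac)
  qed
  ultimately show ?case using insert.hyps by simp
qed

section \<open>Riemann integrability of continuous test functions\<close>

lemma continuous_imp_Riemann_integrable:
  fixes f :: "real \<Rightarrow> complex"
  assumes cont: "continuous_on {a..b} f"
  shows "Riemann_integrable f a b"
  unfolding Riemann_integrable_def
proof (rule exI[of _ "integral {a..b} f"], intro allI impI)
  fix \<epsilon> :: real assume \<epsilon>: "\<epsilon> > 0"
  \<comment> \<open>Admissible oscillation per cell: \<eta> times the total length stays below
    \<epsilon>. The \<open>+ 1\<close> keeps the denominator positive when
    \<open>a = b\<close>.\<close>
  define \<eta> where "\<eta> = \<epsilon> / (2 * (\<bar>b - a\<bar> + 1))"
  have pos: "0 < 2 * (\<bar>b - a\<bar> + 1)"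
    by (rule mult_pos_pos[OF zero_less_numeral add_nonneg_pos[OF abs_ge_zero zero_less_one]])
  have \<eta>: "\<eta> > 0"
    unfolding \<eta>_def by (rule divide_pos_pos[OF \<epsilon> pos])
  have "uniformly_continuous_on {a..b} f"
    using cont by (intro compact_uniformly_continuous) auto
  then obtain \<delta> where \<delta>: "\<delta> > 0"
    and unif: "\<And>x x'. x \<in> {a..b} \<Longrightarrow> x' \<in> {a..b} \<Longrightarrow> dist x' x < \<delta> \<Longrightarrow> dist (f x') (f x) < \<eta>"
    using \<eta> unfolding uniformly_continuous_on_def by metis
  have "norm ((\<Sum>(x, k)\<in>p. measure lborel k *\<^sub>R f x) - integral {a..b} f) < \<epsilon>"
    if p: "p tagged_division_of {a..b}" and fine: "(\<lambda>x. ball x \<delta>) fine p" for p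
  proof -
    have p': "p tagged_division_of cbox a b" using p by simp
    note tag = tagged_division_ofD[OF p']
    have int: "f integrable_on {a..b}"
      using cont by (rule integrable_continuous_interval)
    have "integral {a..b} f = (\<Sum>(x, k)\<in>p. integral k f)"
      using integral_combine_tagged_division_topdown[of f a b p] int p' by simp
    then have "norm ((\<Sum>(x, k)\<in>p. measure lborel k *\<^sub>R f x) - integral {a..b} f)
        = norm (\<Sum>(x, k)\<in>p. measure lborel k *\<^sub>R f x - integral k f)"
      by (simp add: sum_subtractf case_prod_beta)
    also have "\<dots> \<le> (\<Sum>(x, k)\<in>p. \<eta> * measure lborel k)"
      unfolding case_prod_beta
    proof (rule sum_norm_le)
      fix xk assume xk: "xk \<in> p"
      obtain x k where [simp]: "xk = (x, k)" by (cases xk)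
      obtain c d where k: "k = cbox c d" using tag(4)[of x k] xk by (simp only: \<open>xk = (x, k)\<close>) blast
      have sub: "k \<subseteq> {a..b}" and x: "x \<in> k" using tag(2,3) xk by auto
      have kball: "k \<subseteq> ball x \<delta>" using fine xk by (auto simp: fine_def)
      have intk: "f integrable_on k"
        using integrable_subinterval_real[OF int, of c d] sub k by simp
      \<comment> \<open>The error on a cell is the integral of \<open>f x - f u\<close>; the cell
        lies within \<delta> of its tag, so the integrand is at most \<eta> in norm.\<close>
      have "((\<lambda>u. f x - f u) has_integral measure lborel k *\<^sub>R f x - integral k f) k"
        using has_integral_diff[OF has_integral_const[of "f x" c d] integrable_integral[OF intk[unfolded k]]]
        by (simp add: k)
      then have "norm (measure lborel k *\<^sub>R f x - integral k f) \<le> \<eta> * measure lborel k"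
        unfolding k
      proof (rule has_integral_bound[rotated])
        fix u assume "u \<in> cbox c d"
        then have "u \<in> {a..b}" "dist x u < \<delta>" "x \<in> {a..b}"
          using k sub kball x by auto
        from unif[OF this(1,3,2)] show "norm (f x - f u) \<le> \<eta>"
          by (simp add: dist_norm)
      qed (use \<eta> in simp)
      then show "norm (measure lborel (snd xk) *\<^sub>R f (fst xk) - integral (snd xk) f) \<le> \<eta> * measure lborel (snd xk)"
        by simp
    qed
    also have "\<dots> = \<eta> * measure lborel (cbox a b)"
      unfolding additive_content_tagged_division[OF p', symmetric] sum_distrib_left case_prod_beta ..
    also have "\<dots> \<le> \<eta> * \<bar>b - a\<bar>"
      using \<eta> by (intro mult_left_mono) (auto simp: content_real_if)
    also have "\<dots> < \<eta> * (2 * (\<bar>b - a\<bar> + 1))"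
      using \<eta> by (intro mult_strict_left_mono) auto
    also have "\<dots> = \<epsilon>"
      using pos by (simp add: \<eta>_def)
    finally show ?thesis .
  qed
  then show "\<exists>\<delta>>0. \<forall>p. p tagged_division_of {a..b} \<and> (\<lambda>x. ball x \<delta>) fine p \<longrightarrow>
      norm ((\<Sum>(x, k)\<in>p. measure lborel k *\<^sub>R f x) - integral {a..b} f) < \<epsilon>"
    using \<delta> by blast
qed

text \<open>Admits the test functions \<open>u\<^sup>2\<close> and \<open>exp (y * u)\<close> in the
  defining property of \<open>M\<close>.\<close>

lemma continuous_imp_locally_Riemann_integrable:
  "continuous_on UNIV f \<Longrightarrow> locally_Riemann_integrable f"
  unfolding locally_Riemann_integrable_def
  by (auto intro: continuous_imp_Riemann_integrable continuous_on_subset)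

section \<open>Zeta on the critical line\<close>

lemma open_punctured_halfplane: "open ({z. \<sigma> < Re z} - {1})"
  by (intro open_Diff open_halfspace_Re_gt) auto

lemma connected_punctured_halfplane: "connected ({z. \<sigma> < Re z} - {1})"
  by (intro connected_open_delete open_halfspace_Re_gt convex_connected convex_halfspace_Re_gt) simp

lemma zeta_continuation_mono:
  "zeta_continuation \<sigma> f \<Longrightarrow> \<sigma> \<le> \<tau> \<Longrightarrow> zeta_continuation \<tau> f"
  unfolding zeta_continuation_def by (auto elim: holomorphic_on_subset)

lemma zeta_continuation_unique:
  assumes "zeta_continuation \<sigma> f" "zeta_continuation \<tau> g" "\<sigma> < Re s" "\<tau> < Re s" "s \<noteq> 1"
  shows "f s = g s"
\<comment> \<open>For \<open>Re s > 1\<close> both values are the sum of the Dirichlet series.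
  Otherwise \<open>\<upsilon>\<close> below is less than 1, so the half-plane of convergence lies in
  the common domain and the identity theorem applies.\<close>
proof (cases "Re s > 1")
  case True
  then show ?thesis
    using assms by (auto simp: zeta_continuation_def intro: sums_unique2)
next
  case False
  define \<upsilon> where "\<upsilon> = max \<sigma> \<tau>"
  have cont: "zeta_continuation \<upsilon> f" "zeta_continuation \<upsilon> g"
    using assms by (auto intro: zeta_continuation_mono simp: \<upsilon>_def)
  have \<upsilon>: "\<upsilon> < Re s"
    using assms by (simp add: \<upsilon>_def)
  show ?thesis
  proof (rule analytic_continuation_open[of "{z. 1 < Re z}" "{z. \<upsilon> < Re z} - {1}" f g])
    show "{z. 1 < Re z} \<subseteq> {z. \<upsilon> < Re z} - {1}"
      using False \<upsilon> by auto
    have "2 \<in> {z. 1 < Re z}" by simp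
    then show "{z. 1 < Re z} \<noteq> {}" by blast
    show "f z = g z" if "z \<in> {z. 1 < Re z}" for z
      using cont that by (auto simp: zeta_continuation_def intro: sums_unique2)
  qed (use cont \<upsilon> assms(5) in \<open>auto simp: zeta_continuation_def open_punctured_halfplane
    connected_punctured_halfplane open_halfspace_Re_gt\<close>)
qed

lemma zeta_eq:
  assumes "zeta_continuation \<sigma> f" "\<sigma> < 1" "\<sigma> < Re s" "s \<noteq> 1"
  shows "zeta s = f s"
  unfolding zeta_def
proof (rule the_equality)
  show "\<exists>\<sigma>' f'. \<sigma>' < min 1 (Re s) \<and> zeta_continuation \<sigma>' f' \<and> f s = f' s"
    using assms by auto
next
  fix w assume "\<exists>\<sigma>' f'. \<sigma>' < min 1 (Re s) \<and> zeta_continuation \<sigma>' f' \<and> w = f' s"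
  then obtain \<sigma>' f' where "\<sigma>' < Re s" "zeta_continuation \<sigma>' f'" "w = f' s" by auto
  then show "w = f s"
    using zeta_continuation_unique[of \<sigma>' f' \<sigma> f s] assms by simp
qed

text \<open>Lets \<open>zeta\<close> itself serve as the continuation from here on, as soon as some
  continuation exists.\<close>

lemma zeta_continuation_zeta:
  assumes "zeta_continuation \<sigma> f" "\<sigma> < 1"
  shows "zeta_continuation \<sigma> zeta"
proof -
  have "zeta holomorphic_on ({z. \<sigma> < Re z} - {1}) \<longleftrightarrow> f holomorphic_on ({z. \<sigma> < Re z} - {1})"
    using assms by (intro holomorphic_cong refl) (auto intro: zeta_eq)
  moreover have "zeta z = f z" if "Re z > 1" for z
    using assms(2) that by (intro zeta_eq[OF assms]) auto
  ultimately show ?thesis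
    using assms by (simp add: zeta_continuation_def)
qed

section \<open>The alternating series and the value at 1/2\<close>

text \<open>Mean value bound for the map taking t to t^(-z) on the segment from \<open>x\<close> to
  \<open>x + 1\<close>. The extra power of \<open>x\<close> makes the paired alternating series
  converge absolutely for \<open>Re z > 0\<close>.\<close>

lemma norm_powr_diff_le:
  fixes z :: complex
  assumes "x > 0" "Re z > 0"
  shows "norm (1 / of_real x powr z - 1 / of_real (x + 1) powr z) \<le> norm z * x powr (- Re z - 1)"
proof -
  let ?S = "closed_segment (complex_of_real x) (of_real (x + 1))"
  have S: "\<exists>u. t = of_real u \<and> x \<le> u" if "t \<in> ?S" for t
    using that unfolding closed_segment_of_real closed_segment_eq_real_ivl by auto
  have "norm (of_real x powr (- z) - of_real (x + 1) powr (- z))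
      \<le> (norm z * x powr (- Re z - 1)) * norm (complex_of_real x - of_real (x + 1))"
  proof (rule field_differentiable_bound[where f' = "\<lambda>t. - z * t powr (- z - 1)"])
    show "((\<lambda>t. t powr (- z)) has_field_derivative - z * t powr (- z - 1)) (at t within ?S)" if t: "t \<in> ?S" for t
    proof -
      obtain u where "t = of_real u" "x \<le> u" using S[OF t] by blast
      with assms have "t \<notin> \<real>\<^sub>\<le>\<^sub>0" by simp
      then show ?thesis
        by (rule has_field_derivative_at_within[OF has_field_derivative_powr])
    qed
    show "norm (- z * t powr (- z - 1)) \<le> norm z * x powr (- Re z - 1)" if t: "t \<in> ?S" for t
    proof -
      obtain u where u: "t = of_real u" "x \<le> u" using S[OF t] by blast
      have "norm (t powr (- z - 1)) = u powr (- Re z - 1)"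
        using u assms by (simp add: norm_powr_real_powr)
      also have "\<dots> \<le> x powr (- Re z - 1)"
        using u assms by (intro powr_mono2') auto
      finally show ?thesis
        by (simp add: norm_mult mult_left_mono)
    qed
  qed auto
  moreover have "norm (complex_of_real x - of_real (x + 1)) = 1"
    by simp
  ultimately show ?thesis
    by (simp add: powr_minus_divide)
qed

text \<open>Two consecutive terms of the Dirichlet eta series are paired. The unreduced
  \<open>2 * real n + 1 + 1\<close> matches \<open>norm_powr_diff_le\<close> at
  \<open>x = 2 * real n + 1\<close>.\<close>

definition eta_term :: "nat \<Rightarrow> complex \<Rightarrow> complex" where
  "eta_term n z = 1 / of_real (2 * real n + 1) powr z - 1 / of_real (2 * real n + 1 + 1) powr z"

definition eta :: "complex \<Rightarrow> complex" where
  "eta z = (\<Sum>n. eta_term n z)"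

lemma summable_Suc_powr:
  assumes "a > 0"
  shows "summable (\<lambda>n. K * real (Suc n) powr (- a - 1))"
  using assms summable_Suc_iff[of "\<lambda>n. real n powr (- a - 1)"]
  by (intro summable_mult) (simp add: summable_real_powr_iff)

text \<open>A majorant independent of \<open>z\<close> on bounded parts of the half-plane
  \<open>a \<le> Re z\<close>, as the Weierstrass test requires.\<close>

lemma norm_eta_term_le:
  assumes "a > 0" "a \<le> Re z" "norm z \<le> K"
  shows "norm (eta_term n z) \<le> K * real (Suc n) powr (- a - 1)"
proof -
  have "norm (eta_term n z) \<le> norm z * (2 * real n + 1) powr (- Re z - 1)"
    unfolding eta_term_def using assms by (intro norm_powr_diff_le) auto
  also have "\<dots> \<le> K * (2 * real n + 1) powr (- a - 1)"
    using assms by (intro mult_mono powr_mono order_trans[OF norm_ge_zero assms(3)]) auto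
  also have "\<dots> \<le> K * real (Suc n) powr (- a - 1)"
    using assms by (intro mult_left_mono powr_mono2' order_trans[OF norm_ge_zero assms(3)]) auto
  finally show ?thesis .
qed

lemma eta_term_sums:
  assumes "Re z > 0"
  shows "(\<lambda>n. eta_term n z) sums eta z"
  unfolding eta_def
  by (rule summable_sums, rule summable_comparison_test'[OF summable_Suc_powr[OF assms]])
    (use assms norm_eta_term_le[OF assms] in auto)

lemma holomorphic_eta: "eta holomorphic_on {z. 0 < Re z}"
proof (rule holomorphic_uniform_sequence)
  show "(\<lambda>z. \<Sum>i<n. eta_term i z) holomorphic_on {z. 0 < Re z}" for n
    unfolding eta_term_def by (intro holomorphic_intros) auto
  fix w :: complex assume "w \<in> {z. 0 < Re z}"
  then have w: "Re w > 0" by simp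
  \<comment> \<open>A ball of radius \<open>Re w / 2\<close> keeps the real part away from 0 and the
    norm bounded, so one majorant serves the whole ball.\<close>
  have *: "Re w / 2 \<le> Re z \<and> norm z \<le> norm w + Re w / 2" if "z \<in> cball w (Re w / 2)" for z
  proof
    have "norm (w - z) \<le> Re w / 2" using that by (simp add: dist_norm)
    then show "Re w / 2 \<le> Re z"
      using complex_Re_le_cmod[of "w - z"] by simp
    show "norm z \<le> norm w + Re w / 2"
      using \<open>norm (w - z) \<le> Re w / 2\<close> norm_triangle_ineq2[of z w] by (simp add: norm_minus_commute)
  qed
  have "uniform_limit (cball w (Re w / 2)) (\<lambda>n z. \<Sum>i<n. eta_term i z) eta sequentially"
    unfolding eta_def[abs_def]
  proof (rule Weierstrass_m_test)
    show "norm (eta_term n z) \<le> (norm w + Re w / 2) * real (Suc n) powr (- (Re w / 2) - 1)"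
      if "z \<in> cball w (Re w / 2)" for n z
      using *[OF that] w by (intro norm_eta_term_le) auto
    show "summable (\<lambda>n. (norm w + Re w / 2) * real (Suc n) powr (- (Re w / 2) - 1))"
      using w by (intro summable_Suc_powr) simp
  qed
  moreover have "cball w (Re w / 2) \<subseteq> {z. 0 < Re z}"
    using * w by fastforce
  ultimately show "\<exists>d>0. cball w d \<subseteq> {z. 0 < Re z} \<and>
      uniform_limit (cball w d) (\<lambda>n z. \<Sum>i<n. eta_term i z) eta sequentially"
    using w by (intro exI[of _ "Re w / 2"]) auto
qed (rule open_halfspace_Re_gt)

text \<open>Subtracting the even-indexed part of the Dirichlet series twice produces the alternating
  signs, and that part is 2^(-z) times the whole series.\<close>

lemma eta_eq_times_zeta:
  assumes Z: "zeta_continuation \<sigma> Z" and "Re z > 1"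
  shows "(1 - 2 * 2 powr (- z)) * Z z = eta z"
proof -
  let ?f = "\<lambda>n. 1 / complex_of_nat (Suc n) powr z"
  have f: "?f sums Z z"
    using Z \<open>Re z > 1\<close> by (simp add: zeta_continuation_def)
  have "(\<lambda>n. sum ?f {n * 2..<n * 2 + 2}) sums Z z"
    by (rule sums_group[OF f]) simp
  moreover have "(\<lambda>n. 2 * 2 powr (- z) * ?f n) sums (2 * 2 powr (- z) * Z z)"
    by (rule sums_mult[OF f])
  ultimately have "(\<lambda>n. sum ?f {n * 2..<n * 2 + 2} - 2 * 2 powr (- z) * ?f n) sums
      (Z z - 2 * 2 powr (- z) * Z z)"
    by (rule sums_diff)
  moreover have "sum ?f {n * 2..<n * 2 + 2} - 2 * 2 powr (- z) * ?f n = eta_term n z" for n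
  proof -
    have "{n * 2..<n * 2 + 2} = {2 * n, 2 * n + 1}" by auto
    then have "sum ?f {n * 2..<n * 2 + 2} = ?f (2 * n) + ?f (2 * n + 1)" by simp
    moreover have "2 powr (- z) * ?f n = ?f (2 * n + 1)"
    proof -
      have eq: "complex_of_nat (Suc (2 * n + 1)) = 2 * of_nat (Suc n)" by simp
      have "complex_of_nat (Suc (2 * n + 1)) powr z = 2 powr z * of_nat (Suc n) powr z"
        unfolding eq by (rule powr_times_real_left) auto
      then show ?thesis by (simp add: powr_minus_divide)
    qed
    moreover have "eta_term n z = ?f (2 * n) - ?f (2 * n + 1)"
      by (simp add: eta_term_def add_ac)
    ultimately show ?thesis by (simp only: mult.assoc) (simp add: algebra_simps)
  qed
  ultimately have "eta z = Z z - 2 * 2 powr (- z) * Z z"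
    unfolding eta_def by (simp only: sums_iff)
  then show ?thesis by (simp add: algebra_simps)
qed

text \<open>At 1/2 each paired term is a positive real, since t^(-1/2) decreases.\<close>

lemma eta_half_nonzero: "eta (1 / 2) \<noteq> 0"
proof -
  have Re: "Re (eta_term n (1 / 2)) > 0" for n
  proof -
    have "1 / (complex_of_real x powr (1 / 2)) = of_real (1 / x powr (1 / 2))" if "x > 0" for x
      using powr_of_real[of x "1/2"] that by simp
    then have "eta_term n (1 / 2) = of_real (1 / (2 * real n + 1) powr (1 / 2) - 1 / (2 * real n + 1 + 1) powr (1 / 2))"
      unfolding eta_term_def by (simp only: of_real_diff)
    moreover have "1 / (2 * real n + 1 + 1) powr (1 / 2) < 1 / (2 * real n + 1) powr (1 / 2)"
      by (intro divide_strict_left_mono powr_less_mono2 mult_pos_pos) auto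
    ultimately show ?thesis by simp
  qed
  have "(\<lambda>n. Re (eta_term n (1 / 2))) sums Re (eta (1 / 2))"
    by (intro sums_Re eta_term_sums) simp
  then have "Re (eta (1 / 2)) > 0"
    using suminf_pos[of "\<lambda>n. Re (eta_term n (1 / 2))"] Re by (auto simp: sums_iff)
  then show ?thesis by auto
qed

lemma zeta_half_nonzero:
  assumes "zeta_continuation \<sigma> zeta" "\<sigma> < 1 / 2"
  shows "zeta (1 / 2) \<noteq> 0"
proof -
  \<comment> \<open>The maximum with 0 keeps the domain inside the half-plane where
    \<open>eta\<close> is known to be holomorphic.\<close>
  define \<tau> where "\<tau> = max \<sigma> 0"
  have cont: "zeta_continuation \<tau> zeta" and \<tau>: "0 \<le> \<tau>" "\<tau> < 1 / 2"
    using assms by (auto simp: \<tau>_def intro: zeta_continuation_mono)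
  have "(1 - 2 * 2 powr (- (1 / 2))) * zeta (1 / 2) = eta (1 / 2)"
  proof (rule analytic_continuation_open[of "{z. 1 < Re z}" "{z. \<tau> < Re z} - {1}"
        "\<lambda>z. (1 - 2 * 2 powr (- z)) * zeta z" eta])
    show "{z. 1 < Re z} \<subseteq> {z. \<tau> < Re z} - {1}"
      using \<tau> by auto
    have "2 \<in> {z. 1 < Re z}" by simp
    then show "{z. 1 < Re z} \<noteq> {}" by blast
    show "(\<lambda>z. (1 - 2 * 2 powr (- z)) * zeta z) holomorphic_on ({z. \<tau> < Re z} - {1})"
      using cont by (intro holomorphic_intros) (auto simp: zeta_continuation_def)
    show "eta holomorphic_on ({z. \<tau> < Re z} - {1})"
      by (rule holomorphic_on_subset[OF holomorphic_eta]) (use \<tau> in auto)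
    have "(1 / 2 :: complex) \<noteq> 1" by (simp add: complex_eq_iff)
    then show "1 / 2 \<in> {z. \<tau> < Re z} - {1}"
      using \<tau> by simp
  qed (use eta_eq_times_zeta[OF cont] in \<open>auto simp: open_punctured_halfplane
    connected_punctured_halfplane open_halfspace_Re_gt\<close>)
  with eta_half_nonzero show ?thesis by auto
qed

section \<open>Symmetry under complex conjugation\<close>

text \<open>The Dirichlet series has real coefficients, so the reflected function is again a
  continuation, and uniqueness identifies it with \<open>zeta\<close>.\<close>

lemma zeta_cnj:
  assumes "zeta_continuation \<sigma> zeta" "\<sigma> < Re s" "s \<noteq> 1"
  shows "zeta (cnj s) = cnj (zeta s)"
proof -
  have "zeta_continuation \<sigma> (cnj \<circ> zeta \<circ> cnj)"
    unfolding zeta_continuation_def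
  proof (intro conjI allI impI)
    have "cnj ` ({z. \<sigma> < Re z} - {1}) = {z. \<sigma> < Re z} - {1}"
      unfolding image_cnj_conv_vimage_cnj by (auto simp: complex_eq_iff)
    then show "cnj \<circ> zeta \<circ> cnj holomorphic_on ({z. \<sigma> < Re z} - {1})"
      using assms(1) by (intro holomorphic_on_compose_cnj_cnj open_punctured_halfplane)
        (simp add: zeta_continuation_def)
    fix z :: complex assume "1 < Re z"
    then have "(\<lambda>n. cnj (1 / of_nat (Suc n) powr cnj z)) sums cnj (zeta (cnj z))"
      using assms(1) unfolding sums_cnj by (simp add: zeta_continuation_def)
    moreover have "cnj (1 / of_nat (Suc n) powr cnj z) = 1 / of_nat (Suc n) powr z" for n
      by (simp add: cnj_powr flip: of_nat_Suc)
    ultimately show "(\<lambda>n. 1 / of_nat (Suc n) powr z) sums (cnj \<circ> zeta \<circ> cnj) z"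
      by simp
  qed
  from zeta_continuation_unique[OF assms(1) this assms(2,2,3)] show ?thesis
    by (metis comp_apply complex_cnj_cnj)
qed

text \<open>Conjugating the local factorization at \<rho> gives one at the conjugate point with the
  same exponent. The hypothesis \<open>nz\<close> excludes that \<open>zeta\<close> vanishes
  identically.\<close>

lemma zero_mult_cnj:
  assumes cont: "zeta_continuation \<sigma> zeta" and \<rho>: "\<sigma> < Re \<rho>" "\<rho> \<noteq> 1"
    and nz: "\<exists>w. \<sigma> < Re w \<and> w \<noteq> 1 \<and> zeta w \<noteq> 0"
  shows "zero_mult (cnj \<rho>) = zero_mult \<rho>"
proof -
  let ?S = "{z. \<sigma> < Re z} - {1}"
  define n where "n = zorder zeta \<rho>"
  define g where "g = zor_poly zeta \<rho>"
  have *: "(if zeta \<rho> = 0 then n > 0 else n = 0) \<and> (\<exists>r>0. cball \<rho> r \<subseteq> ?S \<and> g holomorphic_on cball \<rho> r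
      \<and> (\<forall>w\<in>cball \<rho> r. zeta w = g w * (w - \<rho>) ^ nat n \<and> g w \<noteq> 0))"
    unfolding n_def g_def
    by (rule zorder_exist_zero)
      (use cont \<rho> nz open_punctured_halfplane connected_punctured_halfplane in \<open>auto simp: zeta_continuation_def\<close>)
  from * have n: "n \<ge> 0"
    by (simp split: if_splits)
  from * obtain r where r: "r > 0" "cball \<rho> r \<subseteq> ?S" "g holomorphic_on cball \<rho> r"
    and g: "\<And>w. w \<in> cball \<rho> r \<Longrightarrow> zeta w = g w * (w - \<rho>) ^ nat n \<and> g w \<noteq> 0"
    by blast
  have ball: "cnj w \<in> ball \<rho> r" if "w \<in> ball (cnj \<rho>) r" for w
    using that by (simp add: dist_norm flip: complex_cnj_diff) (metis complex_cnj_cnj complex_cnj_diff complex_mod_cnj)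
  have "zorder zeta (cnj \<rho>) = n"
  proof (rule zorder_eqI)
    have "cnj ` ball (cnj \<rho>) r \<subseteq> cball \<rho> r"
      using ball by force
    then show "cnj \<circ> g \<circ> cnj holomorphic_on ball (cnj \<rho>) r"
      using holomorphic_on_subset[OF r(3)] by (intro holomorphic_on_compose_cnj_cnj) auto
    show "(cnj \<circ> g \<circ> cnj) (cnj \<rho>) \<noteq> 0"
      using g[of \<rho>] r by simp
    fix w assume w: "w \<in> ball (cnj \<rho>) r" "w \<noteq> cnj \<rho>"
    have w': "cnj w \<in> cball \<rho> r" using ball[OF w(1)] by auto
    then have "\<sigma> < Re (cnj w)" "cnj w \<noteq> 1" using r(2) by auto
    from zeta_cnj[OF cont this] have "zeta w = cnj (zeta (cnj w))" by simp
    also have "\<dots> = (cnj \<circ> g \<circ> cnj) w * (w - cnj \<rho>) ^ nat n"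
      using g[OF w'] by simp
    also have "(w - cnj \<rho>) ^ nat n = (w - cnj \<rho>) powi n"
      using n by (simp add: power_int_def)
    finally show "zeta w = (cnj \<circ> g \<circ> cnj) w * (w - cnj \<rho>) powi n" .
  qed (use r in auto)
  then show ?thesis by (simp add: zero_mult_def n_def)
qed

text \<open>
  If no continuation reaches beyond the critical line, then \<open>zeta\<close> takes a single unspecified
  value to the left of it. Under the Riemann hypothesis this value is not 0, so that there are no
  zeros on the critical line either.
\<close>

lemma RH_imp_zeta_continuation:
  assumes RH: "Riemann_hypothesis" and "nontrivial_zeros \<noteq> {}"
  obtains \<sigma> where "\<sigma> < 1 / 2" "zeta_continuation \<sigma> zeta"
proof -
  obtain \<rho> where \<rho>: "\<rho> \<in> nontrivial_zeros" "Re \<rho> = 1 / 2"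
    using assms by (auto simp: Riemann_hypothesis_def)
  have "\<exists>\<sigma> f. \<sigma> < 1 / 2 \<and> zeta_continuation \<sigma> f"
  proof (rule ccontr)
    assume no: "\<nexists>\<sigma> f. \<sigma> < 1 / 2 \<and> zeta_continuation \<sigma> f"
    \<comment> \<open>\<open>zeta_def\<close> asks for \<open>\<sigma> < min 1 (Re s)\<close>, here
      at most 1/2, so its description is never satisfied.\<close>
    have "zeta s = (THE w. False)" if "Re s \<le> 1 / 2" for s
      unfolding zeta_def using no that by (intro arg_cong[of _ _ The] ext) force
    then have "zeta (1 / 4) = zeta \<rho>"
      using \<rho> by simp
    then have "1 / 4 \<in> nontrivial_zeros"
      using \<rho> by (simp add: nontrivial_zeros_def)
    with RH show False by (auto simp: Riemann_hypothesis_def)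
  qed
  then show ?thesis
    using that zeta_continuation_zeta by force
qed

section \<open>The expansion of \<open>H\<^sub>1\<close>\<close>

text \<open>Test the defining property with \<open>\<Phi> u = u\<^sup>2\<close>.\<close>

lemma is_M_function_nonzero:
  assumes M: "is_M_function H M"
  shows "\<exists>t. H (exp t) \<noteq> 0"
proof (rule ccontr)
  assume "\<nexists>t. H (exp t) \<noteq> 0"
  then have H0: "H (exp t) = 0" for t by blast
  from M have cont: "continuous_on UNIV M" and pos: "\<And>u. 0 \<le> M u"
    and supp: "compact (closure {u. M u \<noteq> 0})" and one: "1 / sqrt (2 * pi) * integral UNIV M = 1"
    by (auto simp: is_M_function_def)
  let ?\<Phi> = "\<lambda>u. complex_of_real (u\<^sup>2)"
  have "locally_Riemann_integrable ?\<Phi>"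
    by (intro continuous_imp_locally_Riemann_integrable continuous_intros)
  with M have "((\<lambda>T. of_real (1 / T) * integral {0..T} (\<lambda>t. ?\<Phi> (H (exp t)))) \<longlongrightarrow>
      of_real (1 / sqrt (2 * pi)) * integral UNIV (\<lambda>u. of_real (M u) * ?\<Phi> u)) at_top"
    unfolding is_M_function_def by blast
  then have "((\<lambda>T. 0) \<longlongrightarrow>
      of_real (1 / sqrt (2 * pi)) * integral UNIV (\<lambda>u. of_real (M u) * ?\<Phi> u)) (at_top :: real filter)"
    by (simp add: H0)
  then have "of_real (1 / sqrt (2 * pi)) * integral UNIV (\<lambda>u. of_real (M u) * ?\<Phi> u) = 0"
    by (simp only: tendsto_const_iff[OF trivial_limit_at_top_linorder])
  then have int0: "integral UNIV (\<lambda>u. complex_of_real (M u * u\<^sup>2)) = 0"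
    by simp
  \<comment> \<open>Compact support reduces the integral to a bounded interval, where a continuous
    nonnegative function with integral 0 vanishes.\<close>
  obtain a where "a > 0" and a: "\<And>u. u \<in> closure {u. M u \<noteq> 0} \<Longrightarrow> \<bar>u\<bar> \<le> a"
    using compact_imp_bounded[OF supp] by (auto simp: bounded_pos)
  have out: "M u = 0" if "u \<notin> cbox (- a) a" for u
    using a[of u] that closure_subset[of "{u. M u \<noteq> 0}"] by fastforce
  let ?f = "\<lambda>u. M u * u\<^sup>2"
  have contf: "continuous_on (cbox (- a) a) ?f"
    by (intro continuous_intros continuous_on_subset[OF cont]) auto
  then have "(?f has_integral integral (cbox (- a) a) ?f) (cbox (- a) a)"
    by (intro integrable_integral integrable_continuous)
  then have "(?f has_integral integral (cbox (- a) a) ?f) UNIV"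
    by (rule has_integral_on_superset) (auto simp: out)
  then have "((\<lambda>u. complex_of_real (?f u)) has_integral of_real (integral (cbox (- a) a) ?f)) UNIV"
    by (rule has_integral_linear[OF _ bounded_linear_of_real, unfolded o_def])
  with int0 have "integral (cbox (- a) a) ?f = 0"
    using integral_unique of_real_eq_0_iff by metis
  then have "(?f has_integral 0) (cbox (- a) a)"
    using integrable_integral[OF integrable_continuous[OF contf]] by simp
  then have "?f u = 0" if "u \<in> cbox (- a) a" for u
    using has_integral_0_cbox_imp_0[OF contf _ _ _ that] pos \<open>a > 0\<close> by auto
  \<comment> \<open>The factor \<open>u\<^sup>2\<close> gives no information at 0, but a single
    point is negligible, so the total mass would be 0 instead of positive.\<close>
  then have "M u = 0" if "u \<in> UNIV - {0}" for u
    using out[of u] that by fastforce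
  then have "(M has_integral 0) UNIV"
    by (intro has_integral_spike[OF _ _ has_integral_0, of "{0}"]) auto
  then have "integral UNIV M = 0"
    by (rule integral_unique)
  with one show False by simp
qed

text \<open>On the critical line \<rho>(1 - \<rho>) equals 1/4 + \<gamma>^2. Conjugate zeros have
  equal multiplicity and their exponentials add up to a cosine, whence the factor 2 in
  \<open>a\<close>.\<close>

lemma H1_expansion:
  assumes RH: "Riemann_hypothesis" and nz: "\<exists>t. H1 (exp t) \<noteq> 0"
    and a: "\<And>\<gamma>. a \<gamma> = 2 * (real (zero_mult (Complex (1 / 2) \<gamma>)) / (1 / 4 + \<gamma>\<^sup>2))"
  shows "a summable_on ordinates"
    and "H1 (exp t) = (\<Sum>\<^sub>\<infinity>\<gamma>\<in>ordinates. a \<gamma> * cos (\<gamma> * t))"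
proof -
  let ?z = "Complex (1 / 2)"
  define b where "b \<gamma> = real (zero_mult (?z \<gamma>)) / (1 / 4 + \<gamma>\<^sup>2)" for \<gamma>
  have a_eq: "a \<gamma> = 2 * b \<gamma>" for \<gamma>
    by (simp add: a b_def)
  let ?term = "\<lambda>t \<rho>. of_nat (zero_mult \<rho>) * (of_real (exp t) powr (\<rho> - 1 / 2) / (\<rho> * (1 - \<rho>)))"
  have pos: "1 / 4 + \<gamma>\<^sup>2 > 0" for \<gamma> :: real
    by (intro add_pos_nonneg) auto
  have b_nonneg: "b \<gamma> \<ge> 0" for \<gamma>
    using pos[of \<gamma>] by (simp add: b_def)
  have zterm: "?term t (?z \<gamma>) = of_real (b \<gamma>) * cis (\<gamma> * t)" for t \<gamma>
  proof -
    have "?z \<gamma> * (1 - ?z \<gamma>) = of_real (1 / 4 + \<gamma>\<^sup>2)"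
      by (simp add: complex_eq_iff power2_eq_square)
    moreover have "of_real (exp t) powr (?z \<gamma> - 1 / 2) = cis (\<gamma> * t)"
    proof -
      have "?z \<gamma> - 1 / 2 = \<i> * of_real \<gamma>"
        by (simp add: complex_eq_iff)
      moreover have "Ln (complex_of_real (exp t)) = of_real t"
        by (subst Ln_of_real) auto
      ultimately show ?thesis
        by (simp add: powr_def cis_conv_exp mult_ac)
    qed
    ultimately show ?thesis by (simp add: b_def)
  qed
  obtain t0 where t0: "H1 (exp t0) \<noteq> 0" using nz by blast
  then have summ0: "?term t0 summable_on nontrivial_zeros"
  proof (rule contrapos_np)
    assume not_summable: "\<not> ?term t0 summable_on nontrivial_zeros"
    show "H1 (exp t0) = 0"
      unfolding H1_def infsum_not_exists[OF not_summable] by simp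
  qed
  \<comment> \<open>An empty sum would make \<open>H1\<close> vanish; a zero is what
    \<open>RH_imp_zeta_continuation\<close> needs.\<close>
  have "nontrivial_zeros \<noteq> {}"
    using t0 by (auto simp: H1_def)
  then obtain \<sigma> where \<sigma>: "\<sigma> < 1 / 2" "zeta_continuation \<sigma> zeta"
    using RH_imp_zeta_continuation[OF RH] by blast
  have zero_iff: "\<rho> \<in> nontrivial_zeros \<longleftrightarrow> Re \<rho> = 1 / 2 \<and> zeta \<rho> = 0" for \<rho>
    using RH by (auto simp: Riemann_hypothesis_def nontrivial_zeros_def)
  have half: "?z 0 \<notin> nontrivial_zeros"
  proof -
    have eq: "?z 0 = 1 / 2" by (simp add: complex_eq_iff)
    show ?thesis
      unfolding eq zero_iff using zeta_half_nonzero[OF \<sigma>(2,1)] by simp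
  qed
  have neg_zero: "?z (- \<gamma>) \<in> nontrivial_zeros \<longleftrightarrow> ?z \<gamma> \<in> nontrivial_zeros"
    and neg_mult: "zero_mult (?z (- \<gamma>)) = zero_mult (?z \<gamma>)" for \<gamma>
  proof -
    have cnj: "?z (- \<gamma>) = cnj (?z \<gamma>)" and ne: "\<sigma> < Re (?z \<gamma>)" "?z \<gamma> \<noteq> 1"
      using \<sigma> by (auto simp: complex_eq_iff)
    show "?z (- \<gamma>) \<in> nontrivial_zeros \<longleftrightarrow> ?z \<gamma> \<in> nontrivial_zeros"
      unfolding cnj zero_iff zeta_cnj[OF \<sigma>(2) ne] by simp
    have "\<exists>w. \<sigma> < Re w \<and> w \<noteq> 1 \<and> zeta w \<noteq> 0"
      using zeta_half_nonzero[OF \<sigma>(2,1)] \<sigma> by (intro exI[of _ "1 / 2"]) (auto simp: complex_eq_iff)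
    from zero_mult_cnj[OF \<sigma>(2) ne this]
    show "zero_mult (?z (- \<gamma>)) = zero_mult (?z \<gamma>)" unfolding cnj .
  qed
  have b_neg: "b (- \<gamma>) = b \<gamma>" for \<gamma>
    by (simp add: b_def neg_mult)
  have ord: "\<gamma> \<in> ordinates \<longleftrightarrow> 0 < \<gamma> \<and> ?z \<gamma> \<in> nontrivial_zeros" for \<gamma>
  proof -
    have "\<rho> = ?z \<gamma>" if "\<rho> \<in> nontrivial_zeros" "Im \<rho> = \<gamma>" for \<rho>
      using that by (simp add: zero_iff complex_eq_iff)
    then have "(\<exists>\<rho>\<in>nontrivial_zeros. Im \<rho> = \<gamma>) \<longleftrightarrow> ?z \<gamma> \<in> nontrivial_zeros"
      by (metis complex.sel(2))
    then show ?thesis by (simp add: ordinates_def)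
  qed
  define S where "S = ordinates \<union> uminus ` ordinates"
  have zeros: "nontrivial_zeros = ?z ` S"
  proof (intro equalityI subsetI)
    fix \<rho> assume \<rho>: "\<rho> \<in> nontrivial_zeros"
    define \<gamma> where "\<gamma> = Im \<rho>"
    have \<rho>_eq: "\<rho> = ?z \<gamma>"
      using \<rho> by (simp add: zero_iff complex_eq_iff \<gamma>_def)
    then have "\<gamma> \<noteq> 0" using half \<rho> by auto
    then consider "\<gamma> > 0" | "- \<gamma> > 0" by linarith
    then have "\<gamma> \<in> S"
    proof cases
      case 1
      then show ?thesis using \<rho> \<rho>_eq by (simp add: S_def ord)
    next
      case 2
      then have "- \<gamma> \<in> ordinates" using \<rho> \<rho>_eq neg_zero[of \<gamma>] unfolding ord by simp
      then have "- (- \<gamma>) \<in> uminus ` ordinates" by (rule imageI)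
      then show ?thesis by (simp add: S_def)
    qed
    then show "\<rho> \<in> ?z ` S" using \<rho>_eq by blast
  next
    fix \<rho> assume "\<rho> \<in> ?z ` S"
    then show "\<rho> \<in> nontrivial_zeros"
      by (auto simp: S_def ord neg_zero)
  qed
  have inj: "inj_on ?z S" by (auto simp: inj_on_def)
  have "(\<lambda>\<gamma>. of_real (b \<gamma>) * cis (\<gamma> * t0)) summable_on S"
    using summ0 unfolding zeros summable_on_reindex[OF inj] o_def zterm .
  \<comment> \<open>Complex summability is absolute, and the norms are \<open>b \<gamma>\<close> for
    every \<open>t\<close>; summability at \<open>t0\<close> thus carries over to all
    \<open>t\<close>.\<close>
  then have "(\<lambda>\<gamma>. norm (of_real (b \<gamma>) * cis (\<gamma> * t0))) summable_on S"
    by (simp only: summable_on_iff_abs_summable_on_complex)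
  then have b_S: "b summable_on S"
    using b_nonneg by (simp add: norm_mult)
  then have b_ord: "b summable_on ordinates" and b_neg_ord: "b summable_on uminus ` ordinates"
    by (auto intro: summable_on_subset simp: S_def)
  show "a summable_on ordinates"
    using summable_on_cmult_right[OF b_ord, of 2] by (simp add: a_eq[abs_def])
  have cos_summ: "(\<lambda>\<gamma>. b \<gamma> * cos (\<gamma> * t)) summable_on X" if "b summable_on X" for X
  proof (rule abs_summable_summable, rule Infinite_Sum.abs_summable_on_comparison_test'[OF that])
    show "norm (b \<gamma> * cos (\<gamma> * t)) \<le> b \<gamma>" for \<gamma>
      using b_nonneg[of \<gamma>] abs_cos_le_one[of "\<gamma> * t"] by (simp add: abs_mult mult_left_le)
  qed
  have cis_summ: "(\<lambda>\<gamma>. of_real (b \<gamma>) * cis (\<gamma> * t)) summable_on S"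
    using b_S b_nonneg by (simp add: summable_on_iff_abs_summable_on_complex norm_mult)
  have "H1 (exp t) = Re (\<Sum>\<^sub>\<infinity>\<gamma>\<in>S. of_real (b \<gamma>) * cis (\<gamma> * t))"
    unfolding H1_def zeros infsum_reindex[OF inj] o_def zterm ..
  also have "\<dots> = (\<Sum>\<^sub>\<infinity>\<gamma>\<in>S. b \<gamma> * cos (\<gamma> * t))"
    using infsumI[OF has_sum_Re[OF has_sum_infsum[OF cis_summ]]] by simp
  \<comment> \<open>Ordinates are positive, so they are disjoint from their negatives; both
    \<open>b\<close> and the cosine are even, so the two halves agree.\<close>
  also have "\<dots> = (\<Sum>\<^sub>\<infinity>\<gamma>\<in>ordinates. b \<gamma> * cos (\<gamma> * t)) + (\<Sum>\<^sub>\<infinity>\<gamma>\<in>uminus ` ordinates. b \<gamma> * cos (\<gamma> * t))"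
    unfolding S_def
    by (intro infsum_Un_disjoint cos_summ b_ord b_neg_ord) (auto simp: ord)
  also have "(\<Sum>\<^sub>\<infinity>\<gamma>\<in>uminus ` ordinates. b \<gamma> * cos (\<gamma> * t)) = (\<Sum>\<^sub>\<infinity>\<gamma>\<in>ordinates. b \<gamma> * cos (\<gamma> * t))"
    by (subst infsum_reindex) (auto simp: inj_on_def o_def b_neg)
  also have "(\<Sum>\<^sub>\<infinity>\<gamma>\<in>ordinates. b \<gamma> * cos (\<gamma> * t)) + (\<Sum>\<^sub>\<infinity>\<gamma>\<in>ordinates. b \<gamma> * cos (\<gamma> * t))
      = (\<Sum>\<^sub>\<infinity>\<gamma>\<in>ordinates. 2 * (b \<gamma> * cos (\<gamma> * t)))"
    using infsum_cmult_right[of 2 "\<lambda>\<gamma>. b \<gamma> * cos (\<gamma> * t)" ordinates] cos_summ[OF b_ord] by simp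
  also have "\<dots> = (\<Sum>\<^sub>\<infinity>\<gamma>\<in>ordinates. a \<gamma> * cos (\<gamma> * t))"
    by (simp add: a_eq mult.assoc)
  finally show "H1 (exp t) = (\<Sum>\<^sub>\<infinity>\<gamma>\<in>ordinates. a \<gamma> * cos (\<gamma> * t))" .
qed

section \<open>The transform of \<open>M\<close>, the Bessel product and the point mass\<close>

lemma M_transform_has_mean:
  assumes "is_M_function H M"
  shows "has_mean (\<lambda>t. exp (of_real (y * H (exp t)))) (M_transform M (- \<i> * of_real y))"
proof -
  have "locally_Riemann_integrable (\<lambda>u. exp (of_real (y * u)))"
    by (intro continuous_imp_locally_Riemann_integrable continuous_intros)
  with assms have "has_mean (\<lambda>t. exp (of_real (y * H (exp t))))
      (of_real (1 / sqrt (2 * pi)) * integral UNIV (\<lambda>u. of_real (M u) * exp (of_real (y * u))))"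
    unfolding is_M_function_def has_mean_def by blast
  \<comment> \<open>At z = -iy the kernel of the transform becomes the real exponential
    \<open>exp (y * u)\<close>.\<close>
  moreover have "\<i> * complex_of_real u * (- \<i> * of_real y) = of_real (y * u)" for u
    by (simp add: complex_eq_iff)
  ultimately show ?thesis
    unfolding M_transform_def by (simp only:)
qed

text \<open>Finite partial products are the means of exponentials of finite partial sums. These
  exponentials converge uniformly, so their means converge to the mean \<open>c\<close> of the
  limit.\<close>

lemma has_unordered_prod_Bessel_J0:
  fixes a :: "real \<Rightarrow> real"
  assumes indep: "rat_linearly_independent S"
    and a: "a summable_on S" "\<And>\<gamma>. 0 \<le> a \<gamma>"
    and h: "\<And>t. h t = (\<Sum>\<^sub>\<infinity>\<gamma>\<in>S. a \<gamma> * cos (\<gamma> * t))"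
    and mean: "has_mean (\<lambda>t. exp (of_real (y * h t))) c"
  shows "has_unordered_prod (\<lambda>\<gamma>. Bessel_J0 (2 * \<i> * of_real (y * a \<gamma> / 2))) c S"
  unfolding has_unordered_prod_def
proof (rule tendsto_has_mean[OF _ _ _ _ mean])
  let ?P = "\<lambda>F t. exp (complex_of_real (y * (\<Sum>\<gamma>\<in>F. a \<gamma> * cos (\<gamma> * t))))"
  \<comment> \<open>All partial sums lie between \<open>- K\<close> and \<open>K\<close>; on this
    compact interval the exponential is uniformly continuous and preserves uniform
    convergence.\<close>
  define K where "K = (\<Sum>\<^sub>\<infinity>\<gamma>\<in>S. a \<gamma>)"
  have le: "norm (a \<gamma> * cos (\<gamma> * t)) \<le> a \<gamma>" for \<gamma> t
    using a(2)[of \<gamma>] abs_cos_le_one[of "\<gamma> * t"] by (simp add: abs_mult mult_left_le)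
  have "h = (\<lambda>t. \<Sum>\<^sub>\<infinity>\<gamma>\<in>S. a \<gamma> * cos (\<gamma> * t))"
    using h by blast
  then have "uniform_limit UNIV (\<lambda>F t. \<Sum>\<gamma>\<in>F. a \<gamma> * cos (\<gamma> * t)) h (finite_subsets_at_top S)"
    using Weierstrass_m_test_general[of S UNIV "\<lambda>\<gamma> t. a \<gamma> * cos (\<gamma> * t)" a] le a(1) by simp
  then show "uniform_limit UNIV ?P (\<lambda>t. exp (of_real (y * h t))) (finite_subsets_at_top S)"
  proof (rule uniform_limit_compose_uniformly_continuous_on)
    show "uniformly_continuous_on {- K..K} (\<lambda>x. exp (complex_of_real (y * x)))"
      by (intro compact_uniformly_continuous continuous_intros) auto
    have "(\<Sum>\<gamma>\<in>F. a \<gamma> * cos (\<gamma> * t)) \<in> {- K..K}" if F: "finite F" "F \<subseteq> S" for F t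
    proof -
      have "norm (\<Sum>\<gamma>\<in>F. a \<gamma> * cos (\<gamma> * t)) \<le> (\<Sum>\<gamma>\<in>F. a \<gamma>)"
        by (rule sum_norm_le) (rule le)
      also have "\<dots> \<le> K"
        unfolding K_def by (rule finite_sum_le_infsum) (use F a in auto)
      finally show ?thesis by (simp add: abs_le_iff)
    qed
    then show "\<forall>\<^sub>F F in finite_subsets_at_top S. \<forall>t\<in>UNIV. (\<Sum>\<gamma>\<in>F. a \<gamma> * cos (\<gamma> * t)) \<in> {- K..K}"
      by (intro eventually_finite_subsets_at_top_weakI) auto
  qed simp
  show "\<forall>\<^sub>F F in finite_subsets_at_top S. continuous_on UNIV (?P F)"
    by (intro always_eventually allI continuous_intros)
  show "\<forall>\<^sub>F F in finite_subsets_at_top S.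
      has_mean (?P F) (\<Prod>\<gamma>\<in>F. Bessel_J0 (2 * \<i> * of_real (y * a \<gamma> / 2)))"
  proof (rule eventually_finite_subsets_at_top_weakI)
    fix F assume F: "finite F" "F \<subseteq> S"
    then have "rat_real.independent F"
      using indep rat_real.independent_mono by (auto simp: rat_linearly_independent_def)
    \<comment> \<open>The weight \<open>y * a \<gamma> / 2\<close> is chosen so that doubling it
      gives the coefficient \<open>y * a \<gamma>\<close> of the cosine.\<close>
    from has_mean_prod_exp_cos[OF F(1) this, of "\<lambda>\<gamma>. of_real (y * a \<gamma> / 2)"]
    have "has_mean (\<lambda>t. \<Prod>\<gamma>\<in>F. exp (2 * of_real (y * a \<gamma> / 2) * of_real (cos (\<gamma> * t))))
        (\<Prod>\<gamma>\<in>F. Bessel_J0 (2 * \<i> * of_real (y * a \<gamma> / 2)))"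
      by blast
    moreover have "(\<Prod>\<gamma>\<in>F. exp (2 * of_real (y * a \<gamma> / 2) * of_real (cos (\<gamma> * t)))) = ?P F t" for t
      using F(1) by (simp add: exp_sum sum_distrib_left mult_ac)
    ultimately show "has_mean (?P F) (\<Prod>\<gamma>\<in>F. Bessel_J0 (2 * \<i> * of_real (y * a \<gamma> / 2)))"
      by (simp only:)
  qed
qed simp

theorem theorem1p4:
  fixes y :: real and \<mu> :: "real measure" and M :: "real \<Rightarrow> real"
  assumes RH: "Riemann_hypothesis"
    and LI: "rat_linearly_independent ordinates"
    and M: "is_M_function H1 M"
    and y: "y > 0"
    and mu: "infinitely_divisible \<mu>"
    and char_mu: "\<And>t. char \<mu> t = exp (of_real (y * g_H1 t))"
  shows "complex_of_real (measure \<mu> {0}) = exp (of_real (- y * H1 1)) * M_transform M (- \<i> * of_real y)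
    \<and> (\<exists>P. has_unordered_prod
            (\<lambda>\<gamma>. Bessel_J0 (2 * \<i> * of_real y * of_nat (zero_mult (Complex (1 / 2) \<gamma>))
                              / of_real (1 / 4 + \<gamma>\<^sup>2))) P ordinates
        \<and> exp (of_real (- y * H1 1)) * M_transform M (- \<i> * of_real y)
              = exp (of_real (- y * H1 1)) * P)"
proof (intro conjI exI)
  note mean = M_transform_has_mean[OF M, of y]
  have "char \<mu> t = exp (of_real (- y * H1 1)) * exp (of_real (y * H1 (exp t)))" for t
    unfolding char_mu g_H1_def exp_add[symmetric] of_real_add[symmetric] by (simp add: algebra_simps)
  then have "char \<mu> = (\<lambda>t. exp (of_real (- y * H1 1)) * exp (of_real (y * H1 (exp t))))"
    by blast
  then have "has_mean (char \<mu>) (exp (of_real (- y * H1 1)) * M_transform M (- \<i> * of_real y))"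
    using has_mean_mult[OF mean] by (simp only:)
  moreover have "has_mean (char \<mu>) (of_real (measure \<mu> {0}))"
    using mu by (intro has_mean_char) (simp add: infinitely_divisible_def)
  \<comment> \<open>Two means of the same characteristic function coincide, limits at infinity being
    unique.\<close>
  ultimately show "complex_of_real (measure \<mu> {0})
      = exp (of_real (- y * H1 1)) * M_transform M (- \<i> * of_real y)"
    unfolding has_mean_def by (intro tendsto_unique[of at_top]) auto
  define b where "b \<gamma> = real (zero_mult (Complex (1 / 2) \<gamma>)) / (1 / 4 + \<gamma>\<^sup>2)" for \<gamma>
  note expansion = H1_expansion[OF RH is_M_function_nonzero[OF M], of "\<lambda>\<gamma>. 2 * b \<gamma>", OF arg_cong[OF b_def]]
  have "has_unordered_prod (\<lambda>\<gamma>. Bessel_J0 (2 * \<i> * of_real (y * (2 * b \<gamma>) / 2)))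
      (M_transform M (- \<i> * of_real y)) ordinates"
    by (rule has_unordered_prod_Bessel_J0[OF LI expansion(1) _ expansion(2) mean]) (simp add: b_def)
  moreover have "2 * \<i> * of_real (y * (2 * b \<gamma>) / 2)
      = 2 * \<i> * of_real y * of_nat (zero_mult (Complex (1 / 2) \<gamma>)) / of_real (1 / 4 + \<gamma>\<^sup>2)" for \<gamma>
  proof -
    have "y * (2 * b \<gamma>) / 2 = y * b \<gamma>" by simp
    then show ?thesis by (simp only:) (simp add: b_def)
  qed
  \<comment> \<open>This instantiates \<open>P\<close> with the transform itself, so the remaining
    equation is reflexive.\<close>
  ultimately show "has_unordered_prod
      (\<lambda>\<gamma>. Bessel_J0 (2 * \<i> * of_real y * of_nat (zero_mult (Complex (1 / 2) \<gamma>))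
                        / of_real (1 / 4 + \<gamma>\<^sup>2))) (M_transform M (- \<i> * of_real y)) ordinates"
    by (simp only:)
qed (rule refl)

end
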